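(* Let $Q=\mathbb{R}^{2n}$ with coordinates $q=(q^1,\dots,q^{2n})$, let $\alpha=\alpha_i(q)\,dq^i$ be a smooth one-form on $Q$ such that $d\alpha$ is a symplectic form, let $H$ be a smooth real function on $Q$ (defined on the open subset of $Q$ on which the system is considered), and let $h>0$ be a small step size. Let $\Phi_d\colon Q\to Q$, $\Phi_d(q_k)=q_{k+1}$, be the implicit discrete flow induced by the equations $$\frac{\partial\alpha_i}{\partial q^j}\left(\frac{q_k+q_{k+1}}{2}\right)\left(\frac{q_{k+1}^j-q_k^j}{h}\right)=\frac{\partial\alpha_j}{\partial q^i}\left(\frac{q_k+q_{k+1}}{2}\right)\left(\frac{q_{k+1}^j-q_k^j}{h}\right)-\frac{\partial H}{\partial q^i}\left(\frac{q_k+q_{k+1}}{2}\right),\qquad 1\le i\le 2n.$$ Then $\Phi_d$ preserves the symplectic form $d\alpha$, that is, $\Phi_d^*(d\alpha)=d\alpha$, if and only if $\alpha$ has linear components on $Q$.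
   Context: Summation over repeated indices is understood. The equations are the midpoint discretization (using the discretization map $R_d(q,\dot q)=(q-\tfrac12\dot q,\,q+\tfrac12\dot q)$ on $Q$) of the Euler-Lagrange equations $\frac{\partial\alpha_i}{\partial q^j}(q)\,\dot q^j=\frac{\partial\alpha_j}{\partial q^i}(q)\,\dot q^j-\frac{\partial H}{\partial q^i}(q)$ of the singular Lagrangian $L(q,\dot q)=\langle\alpha(q),\dot q\rangle-H(q)$. The superscript in $q_k^j$ is the coordinate index and the subscript is the time-step index. "Implicit discrete flow" means the (in general only locally defined) smooth map $q_k\mapsto q_{k+1}=\Phi_d(q_k)$ such that the pair $(q_k,q_{k+1})$ satisfies the displayed equations. "$\alpha$ has linear components" means $\alpha=\alpha_{ij}\,q^j\,dq^i$ with constants $\alpha_{ij}\in\mathbb{R}$. The case motivating the result is that of $n$ point vortices in the plane with constant strengths $\Gamma_1,\dots,\Gamma_n$ and $q=(x^1,\dots,x^n,y^1,\dots,y^n)$: there $\alpha=\sum_{j}\left(-\tfrac12\Gamma_j y^j\,dx^j+\tfrac12\Gamma_j x^j\,dy^j\right)$ and $H(q)=\frac{1}{4\pi}\sum_{j\neq k}\Gamma_j\Gamma_k\log\left((x^j-x^k)^2+(y^j-y^k)^2\right)$.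
   Formalization: The claim is false for a single H (H=0 gives the identity) and for α=(q^1+1)dq^2; the formal version requires preservation by every local discrete flow for all smooth H, and reads "linear components" as linear components plus an exact one-form df. *)

theory Defs
  imports "HOL-Analysis.Analysis"
begin

section \<open>Smooth maps and partial derivatives\<close>

text \<open>
  Differentiability of order \<open>k\<close> on an open set \<open>S\<close>, by iterated directional derivatives;
  on a finite-dimensional domain this is the usual class \<open>C\<^sup>k\<close>. Only used for open \<open>S\<close>.
\<close>

primrec Ck_on :: "nat \<Rightarrow> 'a::real_normed_vector set \<Rightarrow> ('a \<Rightarrow> 'b::real_normed_vector) \<Rightarrow> bool" where
  "Ck_on 0 S f \<longleftrightarrow> continuous_on S f"
| "Ck_on (Suc k) S f \<longleftrightarrow>
     (\<forall>x\<in>S. f differentiable (at x)) \<and> (\<forall>v. Ck_on k S (\<lambda>x. frechet_derivative f (at x) v))"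

definition smooth_on :: "'a::real_normed_vector set \<Rightarrow> ('a \<Rightarrow> 'b::real_normed_vector) \<Rightarrow> bool" where
  "smooth_on S f \<longleftrightarrow> (\<forall>k. Ck_on k S f)"

definition partial :: "'m::finite \<Rightarrow> (real^'m \<Rightarrow> real) \<Rightarrow> real^'m \<Rightarrow> real" where
  "partial i f q = frechet_derivative f (at q) (axis i 1)"


section \<open>One-forms and two-forms on \<open>Q\<close>\<close>

text \<open>
  A one-form \<open>\<alpha> = \<alpha>\<^sub>i dq\<^sup>i\<close> is given by its coefficient map, \<open>\<alpha>\<^sub>i(q) = \<alpha> q $ i\<close>; a two-form is a
  map \<open>\<omega> q u v\<close> of a point and two tangent vectors.
\<close>

definition ext_deriv :: "(real^'m \<Rightarrow> real^'m::finite) \<Rightarrow> real^'m \<Rightarrow> real^'m \<Rightarrow> real^'m \<Rightarrow> real" where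
  "ext_deriv \<alpha> q u v =
     (\<Sum>i\<in>UNIV. \<Sum>j\<in>UNIV. partial j (\<lambda>x. \<alpha> x $ i) q * (u $ j * v $ i - u $ i * v $ j))"

definition function_differential :: "(real^'m \<Rightarrow> real) \<Rightarrow> real^'m \<Rightarrow> real^'m::finite" where
  "function_differential f q = (\<chi> i. partial i f q)"

text \<open>
  Closedness is stated on constant vector fields, where the bracket terms in the invariant formula
  for the exterior derivative of a two-form vanish.
\<close>

definition closed_two_form :: "(real^'m \<Rightarrow> real^'m::finite \<Rightarrow> real^'m \<Rightarrow> real) \<Rightarrow> bool" where
  "closed_two_form \<omega> \<longleftrightarrow>
     (\<forall>q u v w. frechet_derivative (\<lambda>x. \<omega> x v w) (at q) u
              - frechet_derivative (\<lambda>x. \<omega> x u w) (at q) v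
              + frechet_derivative (\<lambda>x. \<omega> x u v) (at q) w = 0)"

definition symplectic_form :: "(real^'m \<Rightarrow> real^'m::finite \<Rightarrow> real^'m \<Rightarrow> real) \<Rightarrow> bool" where
  "symplectic_form \<omega> \<longleftrightarrow>
     (\<forall>q. bilinear (\<omega> q)) \<and> (\<forall>q u. \<omega> q u u = 0) \<and>
     (\<forall>u v. smooth_on UNIV (\<lambda>q. \<omega> q u v)) \<and>
     closed_two_form \<omega> \<and>
     (\<forall>q u. (\<forall>v. \<omega> q u v = 0) \<longrightarrow> u = 0)"

definition pullback ::
  "(real^'m \<Rightarrow> real^'m::finite) \<Rightarrow> (real^'m \<Rightarrow> real^'m \<Rightarrow> real^'m \<Rightarrow> real)
     \<Rightarrow> real^'m \<Rightarrow> real^'m \<Rightarrow> real^'m \<Rightarrow> real" where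
  "pullback \<Phi> \<omega> q u v =
     \<omega> (\<Phi> q) (frechet_derivative \<Phi> (at q) u) (frechet_derivative \<Phi> (at q) v)"

definition preserves_form_on ::
  "(real^'m) set \<Rightarrow> (real^'m \<Rightarrow> real^'m::finite) \<Rightarrow> (real^'m \<Rightarrow> real^'m \<Rightarrow> real^'m \<Rightarrow> real) \<Rightarrow> bool" where
  "preserves_form_on U \<Phi> \<omega> \<longleftrightarrow> (\<forall>q\<in>U. \<forall>u v. pullback \<Phi> \<omega> q u v = \<omega> q u v)"

text \<open>
  The coefficients of \<open>\<alpha>\<close> enter \<open>d\<alpha>\<close> and the discrete Euler-Lagrange equations only through
  \<open>\<partial>\<^sub>j\<alpha>\<^sub>i - \<partial>\<^sub>i\<alpha>\<^sub>j\<close>, so both are unchanged when an exact form \<open>df\<close> is added to \<open>\<alpha>\<close>; linearity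
  of the components can therefore only be characterized up to such a term.
\<close>

definition linear_components :: "(real^'m \<Rightarrow> real^'m::finite) \<Rightarrow> bool" where
  "linear_components \<alpha> \<longleftrightarrow> (\<exists>a :: 'm \<Rightarrow> 'm \<Rightarrow> real. \<forall>q i. \<alpha> q $ i = (\<Sum>j\<in>UNIV. a i j * q $ j))"


section \<open>The midpoint discretization and its implicit flow\<close>

definition discrete_EL ::
  "(real^'m \<Rightarrow> real^'m::finite) \<Rightarrow> (real^'m \<Rightarrow> real) \<Rightarrow> real \<Rightarrow> real^'m \<Rightarrow> real^'m \<Rightarrow> bool" where
  "discrete_EL \<alpha> H h q q' \<longleftrightarrow>
     (\<forall>i. (\<Sum>j\<in>UNIV. partial j (\<lambda>x. \<alpha> x $ i) (midpoint q q') * ((q' $ j - q $ j) / h)) =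
          (\<Sum>j\<in>UNIV. partial i (\<lambda>x. \<alpha> x $ j) (midpoint q q') * ((q' $ j - q $ j) / h))
            - partial i H (midpoint q q'))"

text \<open>
  \<open>\<Phi>\<close> is an implicit discrete flow with (local) domain \<open>U\<close>. The Hamiltonian is defined on the open
  set \<open>W\<close>; the equations evaluate it only at the midpoint, which therefore has to lie in \<open>W\<close>.
\<close>

definition implicit_discrete_flow ::
  "(real^'m \<Rightarrow> real^'m::finite) \<Rightarrow> (real^'m) set \<Rightarrow> (real^'m \<Rightarrow> real) \<Rightarrow> real
     \<Rightarrow> (real^'m) set \<Rightarrow> (real^'m \<Rightarrow> real^'m) \<Rightarrow> bool" where
  "implicit_discrete_flow \<alpha> W H h U \<Phi> \<longleftrightarrow>
     open U \<and> smooth_on U \<Phi> \<and>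
     (\<forall>q\<in>U. midpoint q (\<Phi> q) \<in> W \<and> discrete_EL \<alpha> H h q (\<Phi> q))"

end

theory Submission
  imports Defs
begin

text \<open>
  Write \<open>\<Omega>(q)\<close> for the skew matrix \<open>\<partial>\<^sub>j\<alpha>\<^sub>i - \<partial>\<^sub>i\<alpha>\<^sub>j\<close> representing \<open>d\<alpha>\<close>. The discrete equations read
  \<open>\<Omega>(m)(q' - q) = -h \<nabla>H(m)\<close> with \<open>m\<close> the midpoint of \<open>q\<close> and \<open>q'\<close>. If \<open>\<Omega>\<close> is constant,
  differentiating along the flow gives \<open>\<Omega>(\<Phi>'u - u) = -h S(\<Phi>'u + u) / 2\<close> with \<open>S\<close> the Hessian of \<open>H\<close>;
  the symmetry of \<open>S\<close>, tested against \<open>\<Phi>'v + v\<close>, is preservation of \<open>d\<alpha>\<close>.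

  Conversely, fix \<open>m\<close> and \<open>x\<close> and take quadratic Hamiltonians
  \<open>H(y) = c \<bullet> (y - m) + t |y - m|\<^sup>2 / 2\<close> with \<open>c\<close> chosen so that the step with midpoint \<open>m\<close> goes from
  \<open>m - x\<close> to \<open>m + x\<close>. Preservation of \<open>d\<alpha>\<close> at this step is an identity quadratic in \<open>t\<close>, valid for all
  large \<open>t\<close>; its leading coefficient gives \<open>\<Omega>(m + x) = \<Omega>(m - x)\<close>. Letting \<open>m\<close> vary over an open set
  makes \<open>\<Omega>\<close> constant, and \<open>\<alpha>\<close> minus its linear part at the origin is then closed, hence exact.
\<close>

section \<open>Maps of class \<open>C\<^sup>k\<close>\<close>

lemma Ck_on_cong:
  assumes "open S" "Ck_on k S f" "\<And>x. x \<in> S \<Longrightarrow> f x = g x"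
  shows "Ck_on k S g"
  using assms(2,3)
proof (induction k arbitrary: f g)
  case 0
  then show ?case by (simp cong: continuous_on_cong)
next
  case (Suc k)
  have "g differentiable (at x)" if "x \<in> S" for x
    using Suc.prems that has_derivative_transform_within_open[OF _ \<open>open S\<close> that]
    unfolding differentiable_def by (metis Ck_on.simps(2) differentiable_def)
  moreover have "Ck_on k S (\<lambda>x. frechet_derivative g (at x) v)" for v
  proof (rule Suc.IH)
    show "Ck_on k S (\<lambda>x. frechet_derivative f (at x) v)"
      using Suc.prems(1) by simp
    show "frechet_derivative f (at x) v = frechet_derivative g (at x) v" if "x \<in> S" for x
      using Suc.prems that frechet_derivative_transform_within_open[OF _ \<open>open S\<close> that, of f g]
      by auto
  qed
  ultimately show ?case by simp
qed

text \<open>Any known derivative may stand in for the choice \<open>frechet_derivative\<close>,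
  because derivatives are unique. The closure lemmas below feed it the usual differentiation
  rules.\<close>

lemma Ck_on_SucI:
  assumes "open S"
    and "\<And>x. x \<in> S \<Longrightarrow> (f has_derivative f' x) (at x)"
    and "\<And>v. Ck_on k S (\<lambda>x. f' x v)"
  shows "Ck_on (Suc k) S f"
proof -
  have "f' x v = frechet_derivative f (at x) v" if "x \<in> S" for x v
    using frechet_derivative_at[OF assms(2)[OF that]] by simp
  then have "Ck_on k S (\<lambda>x. frechet_derivative f (at x) v)" for v
    by (rule Ck_on_cong[OF \<open>open S\<close> assms(3)[of v]])
  then show ?thesis
    using assms(2) by (auto simp: differentiable_def)
qed

lemma Ck_on_SucD:
  assumes "Ck_on (Suc k) S f"
  shows "x \<in> S \<Longrightarrow> (f has_derivative frechet_derivative f (at x)) (at x)"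
    and "Ck_on k S (\<lambda>x. frechet_derivative f (at x) v)"
  using assms frechet_derivative_works by auto

lemma Ck_on_imp_continuous_on: "Ck_on k S f \<Longrightarrow> continuous_on S f"
proof (cases k)
  case (Suc l)
  assume "Ck_on k S f"
  then show ?thesis
    using Ck_on_SucD(1)[of l S f] Suc
    by (intro has_derivative_continuous_on[where f' = "\<lambda>x. frechet_derivative f (at x)"])
       (auto intro: has_derivative_at_withinI)
qed simp

lemma Ck_on_SucD_le: "Ck_on (Suc k) S f \<Longrightarrow> Ck_on k S f"
proof (induction k arbitrary: f)
  case 0
  then show ?case using Ck_on_imp_continuous_on by (metis Ck_on.simps(1))
next
  case (Suc k)
  then show ?case by (metis Ck_on.simps(2))
qed

lemma Ck_on_const: "Ck_on k S (\<lambda>x. c)"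
  by (induction k arbitrary: c) auto

lemma Ck_on_bounded_linear:
  assumes "open S" "bounded_linear L" "Ck_on k S f"
  shows "Ck_on k S (\<lambda>x. L (f x))"
  using assms(3)
proof (induction k arbitrary: f)
  case 0
  then show ?case using assms(2) by (simp add: bounded_linear.continuous_on)
next
  case (Suc k)
  show ?case
    by (rule Ck_on_SucI[OF \<open>open S\<close>, where f' = "\<lambda>x v. L (frechet_derivative f (at x) v)"])
       (use Suc Ck_on_SucD[OF Suc.prems] in \<open>auto intro: bounded_linear.has_derivative[OF assms(2)]\<close>)
qed

lemma Ck_on_ident: "open S \<Longrightarrow> Ck_on k S (\<lambda>x. x)"
proof (cases k)
  case (Suc l)
  assume "open S"
  then show ?thesis
    unfolding Suc by (rule Ck_on_SucI[where f' = "\<lambda>x v. v"]) (auto intro: Ck_on_const)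
qed simp

lemma Ck_on_add:
  assumes "open S" "Ck_on k S f" "Ck_on k S g"
  shows "Ck_on k S (\<lambda>x. f x + g x)"
  using assms(2,3)
proof (induction k arbitrary: f g)
  case 0
  then show ?case by (simp add: continuous_on_add)
next
  case (Suc k)
  show ?case
    by (rule Ck_on_SucI[OF \<open>open S\<close>,
          where f' = "\<lambda>x v. frechet_derivative f (at x) v + frechet_derivative g (at x) v"])
       (use Suc Ck_on_SucD[OF Suc.prems(1)] Ck_on_SucD[OF Suc.prems(2)] in
         \<open>auto intro: has_derivative_add\<close>)
qed

lemma Ck_on_bounded_bilinear:
  assumes "open S" "bounded_bilinear b" "Ck_on k S f" "Ck_on k S g"
  shows "Ck_on k S (\<lambda>x. b (f x) (g x))"
  using assms(3,4)
proof (induction k arbitrary: f g)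
  case 0
  then show ?case using bounded_bilinear.continuous_on[OF assms(2)] by simp
next
  case (Suc k)
  note Df = Ck_on_SucD[OF Suc.prems(1)] and Dg = Ck_on_SucD[OF Suc.prems(2)]
  \<comment> \<open>The Leibniz formula contains \<open>f\<close> and \<open>g\<close>
    undifferentiated, so both are also needed at order \<open>k\<close>.\<close>
  note fg = Suc.prems[THEN Ck_on_SucD_le]
  show ?case
    by (rule Ck_on_SucI[OF \<open>open S\<close>,
          where f' = "\<lambda>x v. b (f x) (frechet_derivative g (at x) v)
            + b (frechet_derivative f (at x) v) (g x)"])
       (intro bounded_bilinear.FDERIV[OF assms(2)] Ck_on_add[OF \<open>open S\<close>] Suc.IH Df Dg fg | assumption)+
qed

lemma Ck_on_scaleR:
  "open S \<Longrightarrow> Ck_on k S f \<Longrightarrow> Ck_on k S g \<Longrightarrow> Ck_on k S (\<lambda>x. f x *\<^sub>R g x)"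
  by (rule Ck_on_bounded_bilinear[OF _ bounded_bilinear_scaleR])

lemma Ck_on_mult:
  fixes f g :: "'a::real_normed_vector \<Rightarrow> real"
  shows "open S \<Longrightarrow> Ck_on k S f \<Longrightarrow> Ck_on k S g \<Longrightarrow> Ck_on k S (\<lambda>x. f x * g x)"
  by (rule Ck_on_bounded_bilinear[OF _ bounded_bilinear_mult])

lemma Ck_on_diff:
  "open S \<Longrightarrow> Ck_on k S f \<Longrightarrow> Ck_on k S g \<Longrightarrow> Ck_on k S (\<lambda>x. f x - g x)"
  using Ck_on_add[of S k f "\<lambda>x. - g x"]
    Ck_on_bounded_linear[of S uminus k g] bounded_linear_minus[OF bounded_linear_ident] by auto

lemma Ck_on_sum:
  "open S \<Longrightarrow> (\<And>i. i \<in> I \<Longrightarrow> Ck_on k S (f i)) \<Longrightarrow> Ck_on k S (\<lambda>x. \<Sum>i\<in>I. f i x)"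
  by (induction I rule: infinite_finite_induct) (auto intro: Ck_on_const Ck_on_add)

lemma Ck_on_prod:
  fixes f :: "'i \<Rightarrow> 'a::real_normed_vector \<Rightarrow> real"
  shows "open S \<Longrightarrow> (\<And>i. i \<in> I \<Longrightarrow> Ck_on k S (f i)) \<Longrightarrow> Ck_on k S (\<lambda>x. \<Prod>i\<in>I. f i x)"
  by (induction I rule: infinite_finite_induct) (auto intro: Ck_on_const Ck_on_mult)

lemma Ck_on_inverse:
  fixes f :: "'a::real_normed_vector \<Rightarrow> real"
  assumes "open S" "Ck_on k S f" "\<And>x. x \<in> S \<Longrightarrow> f x \<noteq> 0"
  shows "Ck_on k S (\<lambda>x. inverse (f x))"
  using assms(2)
proof (induction k)
  case 0
  then show ?case using assms(3) by (auto intro: continuous_on_inverse)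
next
  case (Suc k)
  note D = Ck_on_SucD[OF Suc.prems]
  \<comment> \<open>The derivative of the reciprocal contains the reciprocal again, but one order
    lower, where the induction hypothesis covers it.\<close>
  have "Ck_on k S (\<lambda>x. inverse (f x))"
    using Suc Ck_on_SucD_le by blast
  then have "Ck_on k S (\<lambda>x. (- 1) * (inverse (f x) * frechet_derivative f (at x) v * inverse (f x)))" for v
    by (intro Ck_on_mult Ck_on_const \<open>open S\<close> D(2))
  then show ?case
    by (intro Ck_on_SucI[OF \<open>open S\<close>,
          where f' = "\<lambda>x v. - (inverse (f x) * frechet_derivative f (at x) v * inverse (f x))"])
       (auto intro!: Deriv.has_derivative_inverse D(1) assms(3))
qed

lemma Ck_on_vec_nth: "open S \<Longrightarrow> Ck_on k S f \<Longrightarrow> Ck_on k S (\<lambda>x. f x $ i)"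
  by (rule Ck_on_bounded_linear[OF _ bounded_linear_vec_nth])

lemma Ck_on_vec_lambda:
  fixes f :: "'a::real_normed_vector \<Rightarrow> 'm::finite \<Rightarrow> real"
  assumes "open S" "\<And>i. Ck_on k S (\<lambda>x. f x i)"
  shows "Ck_on k S (\<lambda>x. \<chi> i. f x i)"
proof -
  have "(\<chi> i. f x i) = (\<Sum>i\<in>UNIV. f x i *\<^sub>R axis i 1)" for x
    using basis_expansion[of "\<chi> i. f x i"] by (simp add: scalar_mult_eq_scaleR)
  then show ?thesis
    by (simp only:) (intro Ck_on_sum Ck_on_scaleR Ck_on_const assms)
qed

section \<open>Regularity of determinants, solutions of linear systems, compositions and inverse
  maps\<close>

lemma Ck_on_det:
  fixes A :: "'a::real_normed_vector \<Rightarrow> real^'m^'m"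
  assumes "open S" "\<And>i j. Ck_on k S (\<lambda>x. A x $ i $ j)"
  shows "Ck_on k S (\<lambda>x. det (A x))"
  unfolding det_def by (intro Ck_on_sum Ck_on_mult Ck_on_const Ck_on_prod assms)

text \<open>By Cramer's rule the solution is a rational function of the data.\<close>

lemma Ck_on_linear_solve:
  fixes A :: "'a::real_normed_vector \<Rightarrow> real^'m^'m"
  assumes "open S" "\<And>i j. Ck_on k S (\<lambda>x. A x $ i $ j)" "\<And>i. Ck_on k S (\<lambda>x. b x $ i)"
    and det: "\<And>x. x \<in> S \<Longrightarrow> det (A x) \<noteq> 0"
    and solve: "\<And>x. x \<in> S \<Longrightarrow> A x *v X x = b x"
  shows "Ck_on k S X"
proof -
  let ?A = "\<lambda>x l. (\<chi> i j. if j = l then b x $ i else A x $ i $ j)"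
  have "Ck_on k S (\<lambda>x. det (?A x l))" for l
  proof (rule Ck_on_det[OF \<open>open S\<close>])
    show "Ck_on k S (\<lambda>x. ?A x l $ i $ j)" for i j
      using assms(2,3) by (cases "j = l") simp_all
  qed
  moreover have "Ck_on k S (\<lambda>x. inverse (det (A x)))"
    by (rule Ck_on_inverse[OF \<open>open S\<close> Ck_on_det[OF assms(1,2)] det])
  ultimately have "Ck_on k S (\<lambda>x. \<chi> l. det (?A x l) * inverse (det (A x)))"
    by (intro Ck_on_vec_lambda[OF \<open>open S\<close>] Ck_on_mult[OF \<open>open S\<close>])
  moreover have "X x = (\<chi> l. det (?A x l) * inverse (det (A x)))" if "x \<in> S" for x
    using cramer[OF det[OF that], of "X x" "b x"] solve[OF that]
    by (simp add: divide_inverse)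
  ultimately show ?thesis
    using Ck_on_cong[OF \<open>open S\<close>] by (metis (no_types, lifting))
qed

text \<open>\<open>Ck_on\<close> controls derivatives only in fixed directions; this expansion
  reduces a direction that varies with the point to finitely many fixed ones.\<close>

lemma linear_eq_sum_Basis:
  fixes L :: "'a::euclidean_space \<Rightarrow> 'b::real_vector"
  assumes "linear L"
  shows "L v = (\<Sum>b\<in>Basis. (v \<bullet> b) *\<^sub>R L b)"
proof -
  have "L v = L (\<Sum>b\<in>Basis. (v \<bullet> b) *\<^sub>R b)"
    by (simp add: euclidean_representation)
  also have "\<dots> = (\<Sum>b\<in>Basis. (v \<bullet> b) *\<^sub>R L b)"
    using assms by (simp add: linear_sum linear_cmul)
  finally show ?thesis .
qed

lemma Ck_on_compose:
  fixes g :: "'a::real_normed_vector \<Rightarrow> 'b::euclidean_space"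
  assumes "open S" "open T" "Ck_on k T f" "Ck_on k S g" "g ` S \<subseteq> T"
  shows "Ck_on k S (\<lambda>x. f (g x))"
  using assms(3,4)
proof (induction k arbitrary: f)
  case 0
  then show ?case
    using assms(5) by (auto intro: continuous_on_compose2)
next
  case (Suc k)
  note Df = Ck_on_SucD[OF Suc.prems(1)] and Dg = Ck_on_SucD[OF Suc.prems(2)]
  show ?case
  proof (rule Ck_on_SucI[OF \<open>open S\<close>,
        where f' = "\<lambda>x v. frechet_derivative f (at (g x)) (frechet_derivative g (at x) v)"])
    show "((\<lambda>x. f (g x)) has_derivative
        (\<lambda>v. frechet_derivative f (at (g x)) (frechet_derivative g (at x) v))) (at x)"
      if "x \<in> S" for x
      using that assms(5) diff_chain_at[OF Dg(1) Df(1)] by (auto simp: o_def)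
    \<comment> \<open>The chain rule evaluates the derivative of \<open>f\<close> in a moving
      direction. After expansion, each term is a component of the derivative of \<open>g\<close>
      times a composition covered by the induction hypothesis.\<close>
    have *: "Ck_on k S (\<lambda>x. \<Sum>b\<in>Basis. (frechet_derivative g (at x) v \<bullet> b) *\<^sub>R frechet_derivative f (at (g x)) b)" for v
      by (intro Ck_on_sum Ck_on_scaleR Ck_on_bounded_linear[OF _ bounded_linear_inner_left]
          Suc.IH Df(2) Dg(2) Ck_on_SucD_le[OF Suc.prems(2)] \<open>open S\<close>)
    show "Ck_on k S (\<lambda>x. frechet_derivative f (at (g x)) (frechet_derivative g (at x) v))" for v
    proof (rule Ck_on_cong[OF \<open>open S\<close> *])
      fix x assume "x \<in> S"
      then have "linear (frechet_derivative f (at (g x)))"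
        using assms(5) Df(1) has_derivative_linear by blast
      from linear_eq_sum_Basis[OF this, of "frechet_derivative g (at x) v"]
      show "(\<Sum>b\<in>Basis. (frechet_derivative g (at x) v \<bullet> b) *\<^sub>R frechet_derivative f (at (g x)) b)
          = frechet_derivative f (at (g x)) (frechet_derivative g (at x) v)"
        by simp
    qed
  qed
qed

text \<open>The derivative of the inverse map solves a linear system whose coefficients involve only
  the inverse map itself, which bootstraps its regularity.\<close>

lemma Ck_on_inverse_map:
  fixes f g :: "real^'m::finite \<Rightarrow> real^'m"
  assumes "open V" "open U" "smooth_on U f" "g ` V \<subseteq> U" "continuous_on V g"
    and g: "\<And>y. y \<in> V \<Longrightarrow> (g has_derivative g' y) (at y)"
    and fg: "\<And>y. y \<in> V \<Longrightarrow> f (g y) = y"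
  shows "Ck_on k V g"
proof (induction k)
  case 0
  then show ?case using assms by simp
next
  case (Suc k)
  have f: "Ck_on k U f" for k
    using assms(3) by (simp add: smooth_on_def)
  \<comment> \<open>This differentiates \<open>f \<circ> g\<close>, which is the identity on
    \<open>V\<close>.\<close>
  have inv: "frechet_derivative f (at (g y)) (g' y v) = v" if "y \<in> V" for y v
  proof -
    have "(f has_derivative frechet_derivative f (at (g y))) (at (g y))"
      using Ck_on_SucD(1)[OF f] that assms(4) by blast
    from diff_chain_at[OF g[OF that] this]
    have "(f \<circ> g has_derivative frechet_derivative f (at (g y)) \<circ> g' y) (at y)" .
    moreover have "(f \<circ> g has_derivative (\<lambda>v. v)) (at y)"
      by (rule has_derivative_transform_within_open[OF has_derivative_ident \<open>open V\<close> that])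
         (simp add: fg)
    ultimately show ?thesis
      using has_derivative_unique by (metis comp_apply)
  qed
  let ?A = "\<lambda>y. matrix (frechet_derivative f (at (g y)))"
  have lin: "linear (frechet_derivative f (at (g y)))" if "y \<in> V" for y
    using Ck_on_SucD(1)[OF f] that assms(4) has_derivative_linear by blast
  show ?case
  proof (rule Ck_on_SucI[OF \<open>open V\<close> g])
    fix v
    show "Ck_on k V (\<lambda>y. g' y v)"
    proof (rule Ck_on_linear_solve[OF \<open>open V\<close>])
      show "Ck_on k V (\<lambda>y. ?A y $ i $ j)" for i j
        unfolding matrix_def
        using Ck_on_compose[OF \<open>open V\<close> \<open>open U\<close> Ck_on_SucD(2)[OF f] Suc.IH assms(4)]
        by (simp add: Ck_on_vec_nth \<open>open V\<close>)
      show "Ck_on k V (\<lambda>y. v $ i)" for i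
        by (rule Ck_on_const)
      show "?A y *v g' y v = v" if "y \<in> V" for y
        using matrix_works[of "frechet_derivative f (at (g y))"] lin[OF that] inv[OF that] by simp
      show "det (?A y) \<noteq> 0" if "y \<in> V" for y
      proof -
        \<comment> \<open>A right inverse gives surjectivity, which for a linear map between spaces
          of equal dimension gives injectivity.\<close>
        have "surj (frechet_derivative f (at (g y)))"
          using inv[OF that] by (metis surjI)
        then show ?thesis
          using matrix_works lin[OF that]
          by (metis det_nz_iff_inj linear_matrix_vector_mul_eq linear_surjective_imp_injective)
      qed
    qed
  qed
qed

section \<open>Symmetry of second derivatives and closed one-forms\<close>

text \<open>The mean value theorem is applied twice: along \<open>u\<close> to the increment of
  \<open>f\<close> in direction \<open>v\<close>, then along \<open>v\<close> to the directional
  derivative \<open>f' y u\<close>.\<close>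

lemma second_difference_mvt:
  fixes f :: "'a::real_normed_vector \<Rightarrow> real"
  assumes "s > 0"
    and f: "\<And>a b. \<lbrakk>0 \<le> a; a \<le> s; 0 \<le> b; b \<le> s\<rbrakk> \<Longrightarrow>
      (f has_derivative f' (x + a *\<^sub>R u + b *\<^sub>R v)) (at (x + a *\<^sub>R u + b *\<^sub>R v))"
    and fu: "\<And>a b. \<lbrakk>0 \<le> a; a \<le> s; 0 \<le> b; b \<le> s\<rbrakk> \<Longrightarrow>
      ((\<lambda>y. f' y u) has_derivative fu (x + a *\<^sub>R u + b *\<^sub>R v)) (at (x + a *\<^sub>R u + b *\<^sub>R v))"
  obtains a b where "0 < a" "a < s" "0 < b" "b < s"
    "f (x + s *\<^sub>R u + s *\<^sub>R v) - f (x + s *\<^sub>R u) - f (x + s *\<^sub>R v) + f x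
      = s * (s * fu (x + a *\<^sub>R u + b *\<^sub>R v) v)"
proof -
  have line: "((\<lambda>t. f (p + t *\<^sub>R w)) has_real_derivative f' w) (at t)"
    if "(f has_derivative f') (at (p + t *\<^sub>R w))" for f f' and p w :: 'a and t :: real
  proof -
    have "((\<lambda>t. p + t *\<^sub>R w) has_derivative (\<lambda>c. c *\<^sub>R w)) (at t)"
      by (auto intro!: derivative_eq_intros)
    from diff_chain_at[OF this that]
    have "((\<lambda>t. f (p + t *\<^sub>R w)) has_derivative (\<lambda>c. f' (c *\<^sub>R w))) (at t)"
      by (simp add: o_def)
    moreover have "f' (c *\<^sub>R w) = f' w * c" for c
      using linear_cmul[OF has_derivative_linear[OF that], of c w] by simp
    ultimately show ?thesis
      by (simp add: has_field_derivative_def)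
  qed
  define g where "g = (\<lambda>a. f (x + a *\<^sub>R u + s *\<^sub>R v) - f (x + a *\<^sub>R u))"
  have "(g has_real_derivative f' (x + a *\<^sub>R u + s *\<^sub>R v) u - f' (x + a *\<^sub>R u) u) (at a)"
    if "0 \<le> a" "a \<le> s" for a
    unfolding g_def
    using DERIV_diff[OF line[of f _ "x + s *\<^sub>R v" a u] line[of f _ x a u]]
      f[of a s] f[of a 0] that \<open>s > 0\<close> by (simp add: algebra_simps)
  from MVT2[OF \<open>s > 0\<close> this] obtain a where a: "0 < a" "a < s"
    "g s - g 0 = s * (f' (x + a *\<^sub>R u + s *\<^sub>R v) u - f' (x + a *\<^sub>R u) u)"
    by auto
  have "((\<lambda>b. f' (x + a *\<^sub>R u + b *\<^sub>R v) u) has_real_derivative fu (x + a *\<^sub>R u + b *\<^sub>R v) v) (at b)"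
    if "0 \<le> b" "b \<le> s" for b
    using line[OF fu[of a b]] a that by simp
  from MVT2[OF \<open>s > 0\<close> this] obtain b where b: "0 < b" "b < s"
    "f' (x + a *\<^sub>R u + s *\<^sub>R v) u - f' (x + a *\<^sub>R u) u = s * fu (x + a *\<^sub>R u + b *\<^sub>R v) v"
    by auto
  show thesis
    using that[of a b] a b by (simp add: g_def)
qed

text \<open>The second difference over a parallelogram at \<open>x\<close> is symmetric in
  \<open>u\<close> and \<open>v\<close>, so the two mixed derivatives take a common value at points
  of it. Continuity then excludes a gap at \<open>x\<close>.\<close>

lemma second_derivative_symmetric:
  fixes f :: "'a::real_normed_vector \<Rightarrow> real"
  assumes "open S" "x \<in> S"
    and f: "\<And>y. y \<in> S \<Longrightarrow> (f has_derivative f' y) (at y)"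
    and fu: "\<And>y. y \<in> S \<Longrightarrow> ((\<lambda>y. f' y u) has_derivative fu y) (at y)"
    and fv: "\<And>y. y \<in> S \<Longrightarrow> ((\<lambda>y. f' y v) has_derivative fv y) (at y)"
    and cont: "continuous_on S (\<lambda>y. fu y v)" "continuous_on S (\<lambda>y. fv y u)"
  shows "fu x v = fv x u"
proof (rule ccontr)
  assume "fu x v \<noteq> fv x u"
  \<comment> \<open>With half the gap as tolerance, values near the two different limits cannot
    coincide.\<close>
  define e where "e = \<bar>fu x v - fv x u\<bar> / 2"
  have "e > 0" using \<open>fu x v \<noteq> fv x u\<close> by (simp add: e_def)
  have "\<forall>\<^sub>F y in at x. dist (fu y v) (fu x v) < e" "\<forall>\<^sub>F y in at x. dist (fv y u) (fv x u) < e"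
    using cont \<open>open S\<close> \<open>x \<in> S\<close> \<open>e > 0\<close>
    by (auto simp: continuous_on_eq_continuous_at isCont_def intro!: tendstoD)
  moreover have "\<forall>\<^sub>F y in at x. y \<in> S"
    using \<open>open S\<close> \<open>x \<in> S\<close> eventually_at_topological by blast
  ultimately have "\<forall>\<^sub>F y in at x. y \<in> S \<and> dist (fu y v) (fu x v) < e \<and> dist (fv y u) (fv x u) < e"
    by eventually_elim simp
  then obtain d where "d > 0" and d: "\<And>y. dist y x < d \<Longrightarrow>
      y \<in> S \<and> dist (fu y v) (fu x v) < e \<and> dist (fv y u) (fv x u) < e"
    unfolding eventually_at using \<open>x \<in> S\<close> \<open>e > 0\<close> by (metis UNIV_I dist_self)
  \<comment> \<open>The parallelogram of this size stays within distance \<open>d\<close> of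
    \<open>x\<close>; the summand 1 keeps the denominator positive when \<open>u\<close> and
    \<open>v\<close> vanish.\<close>
  define s where "s = d / (norm u + norm v + 1)"
  have "norm u + norm v + 1 > 0"
    by (simp add: add_nonneg_pos)
  then have "s > 0" "s * (norm u + norm v) < d"
    using \<open>d > 0\<close> by (auto simp: s_def field_simps)
  have near: "dist (x + a *\<^sub>R u + b *\<^sub>R v) x < d" if "0 \<le> a" "a \<le> s" "0 \<le> b" "b \<le> s" for a b
  proof -
    have "dist (x + a *\<^sub>R u + b *\<^sub>R v) x \<le> a * norm u + b * norm v"
      using norm_triangle_ineq[of "a *\<^sub>R u" "b *\<^sub>R v"] that by (simp add: dist_norm add.assoc)
    also have "\<dots> \<le> s * norm u + s * norm v"
      using that by (intro add_mono mult_right_mono) auto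
    finally show ?thesis
      using \<open>s * (norm u + norm v) < d\<close> by (simp add: algebra_simps)
  qed
  obtain a b where ab: "0 < a" "a < s" "0 < b" "b < s"
    "f (x + s *\<^sub>R u + s *\<^sub>R v) - f (x + s *\<^sub>R u) - f (x + s *\<^sub>R v) + f x
      = s * (s * fu (x + a *\<^sub>R u + b *\<^sub>R v) v)"
    by (rule second_difference_mvt[OF \<open>s > 0\<close>, of f f' x u v fu]) (use f fu d near in blast)+
  have near': "dist (x + a *\<^sub>R v + b *\<^sub>R u) x < d" if "0 \<le> a" "a \<le> s" "0 \<le> b" "b \<le> s" for a b
    using near[of b a] that by (simp add: algebra_simps)
  obtain a' b' where ab': "0 < a'" "a' < s" "0 < b'" "b' < s"
    "f (x + s *\<^sub>R v + s *\<^sub>R u) - f (x + s *\<^sub>R v) - f (x + s *\<^sub>R u) + f x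
      = s * (s * fv (x + a' *\<^sub>R v + b' *\<^sub>R u) u)"
    by (rule second_difference_mvt[OF \<open>s > 0\<close>, of f f' x v u fv]) (use f fv d near' in blast)+
  have "s * (s * fu (x + a *\<^sub>R u + b *\<^sub>R v) v) = s * (s * fv (x + a' *\<^sub>R v + b' *\<^sub>R u) u)"
    using ab(5) ab'(5) by (simp add: algebra_simps)
  then have "fu (x + a *\<^sub>R u + b *\<^sub>R v) v = fv (x + a' *\<^sub>R v + b' *\<^sub>R u) u"
    using \<open>s > 0\<close> by simp
  moreover have "dist (fu (x + a *\<^sub>R u + b *\<^sub>R v) v) (fu x v) < e"
    using d near[of a b] ab by simp
  moreover have "dist (fv (x + a' *\<^sub>R v + b' *\<^sub>R u) u) (fv x u) < e"
    using d near'[of a' b'] ab' by simp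
  ultimately show False
    by (simp add: e_def dist_real_def abs_if field_simps split: if_splits)
qed

lemma smooth_on_second_derivative_symmetric:
  fixes f :: "'a::real_normed_vector \<Rightarrow> real"
  assumes "open S" "x \<in> S" "smooth_on S f"
  shows "frechet_derivative (\<lambda>y. frechet_derivative f (at y) u) (at x) v
    = frechet_derivative (\<lambda>y. frechet_derivative f (at y) v) (at x) u"
proof -
  have f: "Ck_on (Suc (Suc 0)) S f"
    using assms(3) unfolding smooth_on_def by blast
  note D = Ck_on_SucD(1)[OF f] and D1 = Ck_on_SucD(2)[OF f]
  show ?thesis
    by (rule second_derivative_symmetric[OF assms(1,2) D Ck_on_SucD(1)[OF D1] Ck_on_SucD(1)[OF D1]])
       (use Ck_on_SucD(2)[OF D1] in simp_all)
qed

text \<open>The potential is \<open>f q = \<integral>\<^sub>0\<^sup>1 \<gamma>(tq) \<bullet> q dt\<close>; symmetry of \<open>D\<gamma>\<close> turns the gradient of the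
  integrand into the \<open>t\<close>-derivative of \<open>t \<gamma>(tq)\<close>.\<close>

lemma poincare_lemma_one_form:
  fixes \<gamma> :: "'a::euclidean_space \<Rightarrow> 'a"
  assumes \<gamma>: "\<And>x. (\<gamma> has_derivative \<gamma>' x) (at x)"
    and cont: "\<And>v. continuous_on UNIV (\<lambda>x. \<gamma>' x v)"
    and sym: "\<And>x u v. \<gamma>' x u \<bullet> v = \<gamma>' x v \<bullet> u"
  obtains f where "\<And>q. (f has_derivative (\<lambda>v. \<gamma> q \<bullet> v)) (at q)"
proof -
  have contg: "continuous_on UNIV \<gamma>"
    using \<gamma> by (rule has_derivative_continuous_on)
  have lin: "linear (\<gamma>' x)" for x
    using \<gamma> has_derivative_linear by blast
  define w where "w = (\<lambda>q (t::real). t *\<^sub>R \<gamma>' (t *\<^sub>R q) q + \<gamma> (t *\<^sub>R q))"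
  define f where "f = (\<lambda>q. integral (cbox 0 1) (\<lambda>t::real. \<gamma> (t *\<^sub>R q) \<bullet> q))"
  \<comment> \<open>Continuity of \<open>\<gamma>'\<close> is assumed only in fixed directions,
    hence the basis expansion.\<close>
  have w_cont: "continuous_on X (\<lambda>(q, t). w q t)" for X
  proof -
    have "w q t = t *\<^sub>R (\<Sum>b\<in>Basis. (q \<bullet> b) *\<^sub>R \<gamma>' (t *\<^sub>R q) b) + \<gamma> (t *\<^sub>R q)" for q t
      unfolding w_def using linear_eq_sum_Basis[OF lin, of "t *\<^sub>R q" q] by simp
    then show ?thesis
      unfolding split_beta
      by (simp only:)
         (intro continuous_intros continuous_on_compose2[OF cont] continuous_on_compose2[OF contg]; simp)
  qed
  have path: "((\<lambda>t. \<gamma> (t *\<^sub>R q)) has_vector_derivative \<gamma>' (t *\<^sub>R q) q) (at t)" for q t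
  proof -
    have "((\<lambda>t. t *\<^sub>R q) has_derivative (\<lambda>c. c *\<^sub>R q)) (at t)"
      by (auto intro!: derivative_eq_intros)
    from diff_chain_at[OF this \<gamma>] show ?thesis
      by (simp add: has_vector_derivative_def o_def linear_cmul[OF lin])
  qed
  have int_w: "(w q has_integral \<gamma> q) (cbox 0 1)" for q
  proof -
    have "((\<lambda>t. t *\<^sub>R \<gamma> (t *\<^sub>R q)) has_vector_derivative w q t) (at t within {0..1})" for t
      unfolding w_def
      by (rule has_vector_derivative_at_within)
         (rule has_vector_derivative_eq_rhs[OF has_vector_derivative_scaleR[OF DERIV_ident path]], simp)
    from fundamental_theorem_of_calculus[OF _ this] show ?thesis
      by simp
  qed
  have "(f has_derivative (\<lambda>v. \<gamma> q \<bullet> v)) (at q)" for q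
  proof -
    \<comment> \<open>Differentiation under the integral needs the derivative of the integrand as a
      continuous family of bounded linear maps; pairing with \<open>w q t\<close> is that
      family.\<close>
    have "(f has_derivative integral (cbox 0 1) (\<lambda>t. blinfun_inner_right (w q t))) (at q within UNIV)"
      unfolding f_def
    proof (rule leibniz_rule)
      show "((\<lambda>q. \<gamma> (t *\<^sub>R q) \<bullet> q) has_derivative blinfun_apply (blinfun_inner_right (w q t)))
          (at q within UNIV)" for q t
      proof -
        have "((\<lambda>q. t *\<^sub>R q) has_derivative (\<lambda>v. t *\<^sub>R v)) (at q)"
          by (auto intro!: derivative_eq_intros)
        from diff_chain_at[OF this \<gamma>]
        have "((\<lambda>q. \<gamma> (t *\<^sub>R q)) has_derivative (\<lambda>v. \<gamma>' (t *\<^sub>R q) (t *\<^sub>R v))) (at q)"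
          by (simp add: o_def)
        from has_derivative_inner[OF this has_derivative_ident]
        have "((\<lambda>q. \<gamma> (t *\<^sub>R q) \<bullet> q) has_derivative
            (\<lambda>v. \<gamma> (t *\<^sub>R q) \<bullet> v + \<gamma>' (t *\<^sub>R q) (t *\<^sub>R v) \<bullet> q)) (at q)" .
        moreover have "\<gamma> (t *\<^sub>R q) \<bullet> v + \<gamma>' (t *\<^sub>R q) (t *\<^sub>R v) \<bullet> q = w q t \<bullet> v" for v
          using sym[of "t *\<^sub>R q" v q] by (simp add: w_def linear_cmul[OF lin] inner_add_left)
        ultimately show ?thesis
          by simp
      qed
      show "(\<lambda>t. \<gamma> (t *\<^sub>R q) \<bullet> q) integrable_on cbox 0 1" for q
        by (intro integrable_continuous continuous_intros continuous_on_compose2[OF contg]) auto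
      show "continuous_on (UNIV \<times> cbox 0 1) (\<lambda>(q, t). blinfun_inner_right (w q t))"
        using bounded_linear.continuous_on[OF bounded_linear_blinfun_inner_right w_cont]
        by (simp add: split_beta)
    qed auto
    moreover have "integral (cbox 0 1) (\<lambda>t. blinfun_inner_right (w q t)) = blinfun_inner_right (\<gamma> q)"
      using has_integral_linear[OF int_w[of q] bounded_linear_blinfun_inner_right]
      by (simp add: o_def integral_unique)
    ultimately show ?thesis
      by simp
  qed
  then show thesis
    using that by blast
qed

section \<open>The discrete Euler-Lagrange equations with constant matrix\<close>

definition EL_matrix :: "(real^'m \<Rightarrow> real^'m::finite) \<Rightarrow> real^'m \<Rightarrow> real^'m^'m" where
  "EL_matrix \<alpha> q = (\<chi> i j. partial j (\<lambda>x. \<alpha> x $ i) q - partial i (\<lambda>x. \<alpha> x $ j) q)"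

lemma ext_deriv_eq_EL_matrix: "ext_deriv \<alpha> q u v = v \<bullet> (EL_matrix \<alpha> q *v u)"
proof -
  let ?P = "\<lambda>i j. partial j (\<lambda>x. \<alpha> x $ i) q"
  have "ext_deriv \<alpha> q u v
      = (\<Sum>i\<in>UNIV. \<Sum>j\<in>UNIV. ?P i j * u $ j * v $ i) - (\<Sum>i\<in>UNIV. \<Sum>j\<in>UNIV. ?P i j * u $ i * v $ j)"
    by (simp add: ext_deriv_def algebra_simps sum_subtractf)
  \<comment> \<open>Renaming the indices in the second sum gives both sums the common factor
    \<open>u $ j * v $ i\<close>.\<close>
  also have "(\<Sum>i\<in>UNIV. \<Sum>j\<in>UNIV. ?P i j * u $ i * v $ j) = (\<Sum>i\<in>UNIV. \<Sum>j\<in>UNIV. ?P j i * u $ j * v $ i)"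
    by (rule sum.swap)
  finally show ?thesis
    by (simp add: inner_vec_def matrix_vector_mult_def EL_matrix_def algebra_simps
        sum_subtractf sum_distrib_left)
qed

lemma EL_matrix_skew: "v \<bullet> (EL_matrix \<alpha> q *v u) = - (u \<bullet> (EL_matrix \<alpha> q *v v))"
  unfolding ext_deriv_eq_EL_matrix[symmetric]
  by (simp add: ext_deriv_def sum_negf[symmetric] algebra_simps)

lemma discrete_EL_iff:
  fixes \<alpha> :: "real^'m::finite \<Rightarrow> real^'m"
  assumes "h > 0"
  shows "discrete_EL \<alpha> H h q q' \<longleftrightarrow>
    EL_matrix \<alpha> (midpoint q q') *v (q' - q) = - h *\<^sub>R function_differential H (midpoint q q')"
proof -
  let ?m = "midpoint q q'"
  have "(\<Sum>j\<in>UNIV. partial j (\<lambda>x. \<alpha> x $ i) ?m * ((q' $ j - q $ j) / h)) =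
      (\<Sum>j\<in>UNIV. partial i (\<lambda>x. \<alpha> x $ j) ?m * ((q' $ j - q $ j) / h)) - partial i H ?m
    \<longleftrightarrow> (EL_matrix \<alpha> ?m *v (q' - q)) $ i = (- h *\<^sub>R function_differential H ?m) $ i" for i
  proof -
    have "(EL_matrix \<alpha> ?m *v (q' - q)) $ i = h *
      ((\<Sum>j\<in>UNIV. partial j (\<lambda>x. \<alpha> x $ i) ?m * ((q' $ j - q $ j) / h)) -
       (\<Sum>j\<in>UNIV. partial i (\<lambda>x. \<alpha> x $ j) ?m * ((q' $ j - q $ j) / h)))"
    proof -
      have "h * (\<Sum>j\<in>UNIV. P j * ((q' $ j - q $ j) / h)) = (\<Sum>j\<in>UNIV. P j * (q' $ j - q $ j))"
        for P :: "'m \<Rightarrow> real"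
        using assms by (simp add: sum_distrib_left)
      then show ?thesis
        by (simp add: matrix_vector_mult_def EL_matrix_def left_diff_distrib sum_subtractf
            right_diff_distrib[of h])
    qed
    moreover have "(- h *\<^sub>R function_differential H ?m) $ i = h * (- partial i H ?m)"
      by (simp add: function_differential_def)
    ultimately show ?thesis
      using assms by (simp only: mult_cancel_left) auto
  qed
  then show ?thesis
    unfolding discrete_EL_def vec_eq_iff by blast
qed

lemma function_differential_inner:
  assumes "f differentiable (at q)"
  shows "function_differential f q \<bullet> v = frechet_derivative f (at q) v"
proof -
  have "linear (frechet_derivative f (at q))"
    using assms linear_frechet_derivative by blast
  then have "frechet_derivative f (at q) (\<Sum>i\<in>UNIV. v $ i *\<^sub>R axis i 1)
      = (\<Sum>i\<in>UNIV. v $ i *\<^sub>R frechet_derivative f (at q) (axis i 1))"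
    by (simp add: linear_sum linear_cmul)
  moreover have "(\<Sum>i\<in>UNIV. v $ i *\<^sub>R axis i 1) = v"
    using basis_expansion[of v] by (simp add: scalar_mult_eq_scaleR)
  ultimately show ?thesis
    by (simp add: inner_vec_def function_differential_def partial_def mult.commute)
qed

section \<open>A constant matrix makes every discrete flow preserve the form\<close>

lemma constant_EL_matrix_preserves:
  assumes "h > 0" "open W" "smooth_on W H"
    and K: "\<And>q. EL_matrix \<alpha> q = K"
    and flow: "implicit_discrete_flow \<alpha> W H h U \<Phi>"
  shows "preserves_form_on U \<Phi> (ext_deriv \<alpha>)"
  unfolding preserves_form_on_def
proof (intro ballI allI)
  fix q u v assume "q \<in> U"
  define P where "P = frechet_derivative \<Phi> (at q)"
  have "open U" and "smooth_on U \<Phi>" and W: "\<And>y. y \<in> U \<Longrightarrow> midpoint y (\<Phi> y) \<in> W"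
    and EL: "\<And>y. y \<in> U \<Longrightarrow> K *v (\<Phi> y - y) = - h *\<^sub>R function_differential H (midpoint y (\<Phi> y))"
    using flow by (simp_all add: implicit_discrete_flow_def discrete_EL_iff[OF \<open>h > 0\<close>] K)
  have P: "(\<Phi> has_derivative P) (at q)"
    using \<open>smooth_on U \<Phi>\<close> \<open>q \<in> U\<close> Ck_on_SucD(1)[of 0 U \<Phi>] unfolding smooth_on_def P_def by blast
  define m where "m = midpoint q (\<Phi> q)"
  have "m \<in> W" using W \<open>q \<in> U\<close> by (simp add: m_def)
  \<comment> \<open>\<open>S w z\<close> is the Hessian of \<open>H\<close> at the midpoint.\<close>
  define S where "S = (\<lambda>w. frechet_derivative (\<lambda>y. frechet_derivative H (at y) w) (at m))"
  have S: "((\<lambda>y. frechet_derivative H (at y) w) has_derivative S w) (at m)" for w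
    unfolding S_def using \<open>smooth_on W H\<close> \<open>m \<in> W\<close>
      Ck_on_SucD(1)[OF Ck_on_SucD(2), of 0 W H m w] unfolding smooth_on_def by blast
  have S_sym: "S w z = S z w" for w z
    unfolding S_def by (rule smooth_on_second_derivative_symmetric[OF assms(2) \<open>m \<in> W\<close> assms(3)])
  have H_diff: "H differentiable (at y)" if "y \<in> W" for y
    using \<open>smooth_on W H\<close> that Ck_on_SucD(1)[of 0 W H] unfolding smooth_on_def differentiable_def by blast
  \<comment> \<open>The discrete equation, paired with a fixed \<open>w\<close>, holds at all points
    of the open set \<open>U\<close>; both sides are differentiated at \<open>q\<close> in direction
    \<open>z\<close>.\<close>
  have main: "w \<bullet> (K *v (P z - z)) = - (h / 2) * S w (P z + z)" for w z
  proof -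
    have "((\<lambda>y. midpoint y (\<Phi> y)) has_derivative (\<lambda>z. (1/2) *\<^sub>R (z + P z))) (at q)"
      unfolding midpoint_def using P by (auto intro!: derivative_eq_intros)
    from diff_chain_at[OF this, of "\<lambda>y. frechet_derivative H (at y) w" "S w"] S[of w]
    have "((\<lambda>y. frechet_derivative H (at (midpoint y (\<Phi> y))) w) has_derivative
        (\<lambda>z. S w ((1/2) *\<^sub>R (z + P z)))) (at q)"
      by (simp add: m_def o_def)
    then have "((\<lambda>y. - h * frechet_derivative H (at (midpoint y (\<Phi> y))) w) has_derivative
        (\<lambda>z. - h * S w ((1/2) *\<^sub>R (z + P z)))) (at q)"
      by (rule has_derivative_mult_right)
    moreover have "((\<lambda>y. - h * frechet_derivative H (at (midpoint y (\<Phi> y))) w) has_derivative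
        (\<lambda>z. w \<bullet> (K *v (P z - z)))) (at q)"
    proof (rule has_derivative_transform_within_open[OF _ \<open>open U\<close> \<open>q \<in> U\<close>])
      show "((\<lambda>y. w \<bullet> (K *v (\<Phi> y - y))) has_derivative (\<lambda>z. w \<bullet> (K *v (P z - z)))) (at q)"
        by (intro has_derivative_inner_right bounded_linear.has_derivative[OF matrix_vector_mul_bounded_linear]
            has_derivative_diff P has_derivative_ident)
      show "w \<bullet> (K *v (\<Phi> y - y)) = - h * frechet_derivative H (at (midpoint y (\<Phi> y))) w"
        if "y \<in> U" for y
        using EL[OF that] function_differential_inner[OF H_diff[OF W[OF that]], of w]
        by (simp add: inner_commute)
    qed
    ultimately have "(\<lambda>z. - h * S w ((1/2) *\<^sub>R (z + P z))) = (\<lambda>z. w \<bullet> (K *v (P z - z)))"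
      by (rule has_derivative_unique)
    from fun_cong[OF this, of z]
    have "w \<bullet> (K *v (P z - z)) = - h * S w ((1/2) *\<^sub>R (z + P z))" by simp
    also have "\<dots> = - (h / 2) * S w (P z + z)"
      using linear_cmul[OF has_derivative_linear[OF S]] by (simp add: add.commute)
    finally show ?thesis .
  qed
  have skew: "b \<bullet> (K *v a) = - (a \<bullet> (K *v b))" for a b
    using EL_matrix_skew[of b \<alpha> q a] by (simp add: K)
  \<comment> \<open>Taking \<open>w = P v + v\<close>, \<open>z = u\<close> and then exchanging
    \<open>u\<close> and \<open>v\<close> gives the same Hessian value. By skewness the mixed terms
    cancel in the expansion.\<close>
  have "(P v + v) \<bullet> (K *v (P u - u)) = (P u + u) \<bullet> (K *v (P v - v))"
    using main S_sym by simp
  then have "P v \<bullet> (K *v P u) = v \<bullet> (K *v u)"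
    using skew[of "P u" "P v"] skew[of u "P v"] skew[of "P u" v] skew[of u v]
    by (simp add: inner_simps matrix_vector_mult_diff_distrib)
  then show "pullback \<Phi> (ext_deriv \<alpha>) q u v = ext_deriv \<alpha> q u v"
    by (simp add: pullback_def ext_deriv_eq_EL_matrix K P_def)
qed

section \<open>Constancy of the matrix versus linearity up to an exact term\<close>

lemma linear_plus_exact_EL_matrix:
  assumes "linear_components \<beta>" "smooth_on UNIV f" "\<And>q. \<alpha> q = \<beta> q + function_differential f q"
  shows "EL_matrix \<alpha> q = EL_matrix \<alpha> 0"
proof -
  obtain a where a: "\<And>q i. \<beta> q $ i = (\<Sum>j\<in>UNIV. a i j * q $ j)"
    using assms(1) unfolding linear_components_def by blast
  define F where "F = (\<lambda>i q. frechet_derivative (\<lambda>x. frechet_derivative f (at x) (axis i 1)) (at q))"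
  have F: "((\<lambda>x. frechet_derivative f (at x) (axis i 1)) has_derivative F i q) (at q)" for i q
    unfolding F_def using assms(2) Ck_on_SucD(1)[OF Ck_on_SucD(2), of 0 UNIV f]
    unfolding smooth_on_def by blast
  have "partial j (\<lambda>x. \<alpha> x $ i) q = a i j + F i q (axis j 1)" for i j q
  proof -
    have "((\<lambda>x. (\<Sum>j\<in>UNIV. a i j * x $ j) + frechet_derivative f (at x) (axis i 1)) has_derivative
       (\<lambda>v. (\<Sum>j\<in>UNIV. a i j * v $ j) + F i q v)) (at q)"
      by (intro has_derivative_add has_derivative_sum has_derivative_mult_right F
          bounded_linear_imp_has_derivative bounded_linear_vec_nth)
    note frechet_derivative_at[OF this]
    moreover have "(\<lambda>x. \<alpha> x $ i) = (\<lambda>x. (\<Sum>j\<in>UNIV. a i j * x $ j) + frechet_derivative f (at x) (axis i 1))"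
      by (simp add: assms(3) a function_differential_def partial_def)
    ultimately have "frechet_derivative (\<lambda>x. \<alpha> x $ i) (at q) = (\<lambda>v. (\<Sum>j\<in>UNIV. a i j * v $ j) + F i q v)"
      by simp
    moreover have "(\<Sum>l\<in>UNIV. a i l * axis j 1 $ l) = a i j"
      by (simp add: axis_def if_distrib cong: if_cong)
    ultimately show ?thesis
      by (simp add: partial_def)
  qed
  \<comment> \<open>The Hessian of \<open>f\<close> is symmetric and drops out, leaving the
    constants \<open>a i j - a j i\<close>.\<close>
  moreover have "F i q (axis j 1) = F j q (axis i 1)" for i j q
    unfolding F_def by (rule smooth_on_second_derivative_symmetric[OF open_UNIV UNIV_I assms(2)])
  ultimately show ?thesis
    by (simp add: EL_matrix_def vec_eq_iff)
qed

text \<open>The matrix is the skew part (without the factor 1/2) of the derivative of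
  \<open>\<alpha>\<close>. If it is constant, subtracting the linear map \<open>D 0\<close> leaves a
  field with symmetric derivative, which has a potential. The constant \<open>\<alpha> 0\<close>
  goes into the exact term.\<close>

lemma constant_EL_matrix_imp_linear_plus_exact:
  assumes "smooth_on UNIV \<alpha>" and K: "\<And>q. EL_matrix \<alpha> q = EL_matrix \<alpha> 0"
  obtains \<beta> f where "linear_components \<beta>" "smooth_on UNIV f" "\<And>q. \<alpha> q = \<beta> q + function_differential f q"
proof -
  have Ck: "Ck_on k UNIV \<alpha>" for k
    using assms(1) by (simp add: smooth_on_def)
  define D where "D = (\<lambda>q. frechet_derivative \<alpha> (at q))"
  have D: "(\<alpha> has_derivative D q) (at q)" for q
    unfolding D_def using Ck_on_SucD(1)[OF Ck] by blast
  have D_Ck: "Ck_on k UNIV (\<lambda>q. D q v)" for k v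
    unfolding D_def using Ck_on_SucD(2)[OF Ck] by blast
  have lin: "linear (D q)" for q
    using D has_derivative_linear by blast
  have part: "partial j (\<lambda>x. \<alpha> x $ i) q = D q (axis j 1) $ i" for i j q
    unfolding partial_def
    by (simp add: frechet_derivative_at[OF bounded_linear.has_derivative[OF bounded_linear_vec_nth D], symmetric])
  have EL: "v \<bullet> (EL_matrix \<alpha> q *v u) = D q u \<bullet> v - D q v \<bullet> u" for q u v
  proof -
    have M: "EL_matrix \<alpha> q = matrix (D q) - transpose (matrix (D q))"
      by (simp add: EL_matrix_def part matrix_def transpose_def vec_eq_iff)
    have "v \<bullet> (transpose (matrix (D q)) *v u) = u \<bullet> (matrix (D q) *v v)"
      by (metis dot_lmul_matrix inner_commute transpose_matrix_vector)
    then show ?thesis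
      by (simp add: M matrix_vector_mult_diff_rdistrib inner_diff_right
          fun_cong[OF matrix_vector_mul(2)[OF lin]] inner_commute)
  qed
  define \<gamma> where "\<gamma> = (\<lambda>q. \<alpha> q - D 0 q)"
  have "(\<gamma> has_derivative (\<lambda>v. D q v - D 0 v)) (at q)" for q
    unfolding \<gamma>_def by (intro has_derivative_diff D linear_imp_has_derivative lin)
  moreover have "continuous_on UNIV (\<lambda>q. D q v - D 0 v)" for v
    using D_Ck[of 0 v] by (intro continuous_intros) simp
  moreover have "(D q u - D 0 u) \<bullet> v = (D q v - D 0 v) \<bullet> u" for q u v
    using EL[of v q u] EL[of v 0 u] K[of q] by (simp add: inner_diff_left)
  ultimately obtain f where f: "\<And>q. (f has_derivative (\<lambda>v. \<gamma> q \<bullet> v)) (at q)"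
    by (rule poincare_lemma_one_form) blast
  show thesis
  proof
    show "linear_components (D 0)"
      unfolding linear_components_def
    proof (intro exI allI)
      fix q i
      have "D 0 q = matrix (D 0) *v q"
        by (simp add: fun_cong[OF matrix_vector_mul(2)[OF lin]])
      then show "D 0 q $ i = (\<Sum>j\<in>UNIV. matrix (D 0) $ i $ j * q $ j)"
        by (simp add: matrix_vector_mult_def)
    qed
    have \<gamma>_Ck: "Ck_on k UNIV (\<lambda>q. \<gamma> q \<bullet> v)" for k v
      unfolding \<gamma>_def
      by (intro Ck_on_bounded_linear[OF open_UNIV bounded_linear_inner_left]
          Ck_on_diff open_UNIV Ck Ck_on_bounded_linear[OF open_UNIV, of "D 0"] Ck_on_ident)
         (use D in \<open>blast intro: has_derivative_bounded_linear\<close>)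
    \<comment> \<open>The derivative of \<open>f\<close> is pairing with the smooth field
      \<open>\<gamma>\<close>, so \<open>f\<close> gains one order.\<close>
    have "Ck_on (Suc k) UNIV f" for k
      by (rule Ck_on_SucI[OF open_UNIV f \<gamma>_Ck])
    then show "smooth_on UNIV f"
      using Ck_on_SucD_le unfolding smooth_on_def by blast
    show "\<alpha> q = D 0 q + function_differential f q" for q
    proof -
      have "function_differential f q = \<gamma> q"
        by (simp add: vec_eq_iff function_differential_def partial_def
            frechet_derivative_at[OF f, symmetric] inner_axis)
      then show ?thesis
        by (simp add: \<gamma>_def)
    qed
  qed
qed

section \<open>Quadratic Hamiltonians and the converse\<close>

text \<open>The two forms are compared at the ends of a step whose linearization involves \<open>B + tR\<close>
  with \<open>t\<close> arbitrarily large; only the terms quadratic in \<open>t\<close> matter.\<close>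

lemma bilinear_eq_from_midpoint_family:
  fixes B R :: "'a::euclidean_space \<Rightarrow> 'a"
  assumes "bilinear \<omega>" "bilinear \<omega>'" "linear B" "linear R" "inj R"
    and eq: "\<And>t a b. inj (\<lambda>a. a - (B a + t *\<^sub>R R a)) \<Longrightarrow>
      \<omega> (a + (B a + t *\<^sub>R R a)) (b + (B b + t *\<^sub>R R b))
        = (\<omega>' (a - (B a + t *\<^sub>R R a)) (b - (B b + t *\<^sub>R R b)) :: real)"
  shows "\<omega> u v = \<omega>' u v"
proof -
  obtain c where c: "c > 0" "\<And>x. c * norm x \<le> norm (R x)"
    using linear_inj_bounded_below_pos[OF \<open>linear R\<close> \<open>inj R\<close>] by blast
  obtain d where d: "d > 0" "\<And>x. norm (x - B x) \<le> d * norm x"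
    using linear_bounded_pos[OF linear_compose_sub[OF linear_id \<open>linear B\<close>]] by auto
  \<comment> \<open>From \<open>T\<close> on, \<open>t *\<^sub>R R a\<close> has norm at least
    \<open>(d + 1) * norm a\<close>, so for nonzero \<open>a\<close> it cannot equal
    \<open>a - B a\<close>.\<close>
  define T where "T = (d + 1) / c"
  have "T > 0" using c d by (simp add: T_def)
  have inj: "inj (\<lambda>a. a - (B a + t *\<^sub>R R a))" if "t \<ge> T" for t
  proof -
    have lin: "linear (\<lambda>a. a - (B a + t *\<^sub>R R a))"
      by (intro linear_compose_sub linear_compose_add linear_compose_scale_right assms linear_ident)
    have "a = 0" if "a - (B a + t *\<^sub>R R a) = 0" for a
    proof -
      have "(d + 1) * norm a = T * (c * norm a)"
        using c by (simp add: T_def)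
      also have "\<dots> \<le> t * norm (R a)"
        using \<open>t \<ge> T\<close> \<open>T > 0\<close> c by (intro mult_mono) auto
      also have "\<dots> = norm (t *\<^sub>R R a)"
        using \<open>t \<ge> T\<close> \<open>T > 0\<close> by simp
      also have "t *\<^sub>R R a = a - B a"
        using that by (simp add: algebra_simps)
      also have "norm (a - B a) \<le> d * norm a"
        by (rule d)
      finally show ?thesis
        by (simp add: algebra_simps)
    qed
    then show ?thesis
      using linear_injective_0[OF lin] by blast
  qed
  have R: "\<omega> (R a) (R b) = \<omega>' (R a) (R b)" for a b
  proof -
    define c0 where "c0 = \<omega> (a + B a) (b + B b) - \<omega>' (a - B a) (b - B b)"
    define c1 where "c1 = \<omega> (a + B a) (R b) + \<omega> (R a) (b + B b) + \<omega>' (a - B a) (R b) + \<omega>' (R a) (b - B b)"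
    define c2 where "c2 = \<omega> (R a) (R b) - \<omega>' (R a) (R b)"
    have poly: "c0 + t * c1 + t * (t * c2) = 0" if "t \<ge> T" for t
    proof -
      have "\<omega> ((a + B a) + t *\<^sub>R R a) ((b + B b) + t *\<^sub>R R b)
          = \<omega>' ((a - B a) - t *\<^sub>R R a) ((b - B b) - t *\<^sub>R R b)"
        using eq[OF inj[OF that], of a b] by (simp add: algebra_simps)
      then show ?thesis
        unfolding bilinear_ladd[OF assms(1)] bilinear_radd[OF assms(1)] bilinear_lmul[OF assms(1)]
          bilinear_rmul[OF assms(1)] bilinear_lsub[OF assms(2)] bilinear_rsub[OF assms(2)]
          bilinear_lmul[OF assms(2)] bilinear_rmul[OF assms(2)] c0_def c1_def c2_def real_scaleR_def
        by (simp add: algebra_simps)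
    qed
    \<comment> \<open>A quadratic polynomial with three distinct zeros has leading coefficient zero;
      \<open>T\<close>, \<open>2 * T\<close> and \<open>3 * T\<close> all lie in the admissible
      range.\<close>
    have "c0 + T * c1 + T * (T * c2) = 0"
      using poly[of T] by simp
    moreover have "c0 + 2 * (T * c1) + 4 * (T * (T * c2)) = 0"
      using poly[of "2 * T"] \<open>T > 0\<close> by (simp add: algebra_simps)
    moreover have "c0 + 3 * (T * c1) + 9 * (T * (T * c2)) = 0"
      using poly[of "3 * T"] \<open>T > 0\<close> by (simp add: algebra_simps)
    ultimately have "T * (T * c2) = 0"
      by linarith
    then show ?thesis
      using \<open>T > 0\<close> by (simp add: c2_def)
  qed
  have "surj R"
    using linear_injective_imp_surjective[OF \<open>linear R\<close> \<open>inj R\<close>] by simp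
  then show ?thesis
    using R by (metis surjD)
qed

text \<open>The midpoint \<open>m\<close> parametrizes the step from \<open>m - X m / 2\<close> to \<open>m + X m / 2\<close>.\<close>

lemma midpoint_flow_exists:
  fixes X :: "real^'m::finite \<Rightarrow> real^'m"
  assumes "h > 0" "open W" "m \<in> W" "smooth_on UNIV X"
    and EL: "\<And>x. x \<in> W \<Longrightarrow> EL_matrix \<alpha> x *v X x = - h *\<^sub>R function_differential H x"
    and A: "\<And>v. frechet_derivative X (at m) v = 2 *\<^sub>R A v"
    and inj: "inj (\<lambda>a. a - A a)"
  obtains U \<Phi> where "implicit_discrete_flow \<alpha> W H h U \<Phi>" "m - (1/2) *\<^sub>R X m \<in> U"
    "\<Phi> (m - (1/2) *\<^sub>R X m) = m + (1/2) *\<^sub>R X m"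
    "\<And>a. frechet_derivative \<Phi> (at (m - (1/2) *\<^sub>R X m)) (a - A a) = a + A a"
proof -
  \<comment> \<open>\<open>F\<close> sends the midpoint of a step to its starting point; a local
    inverse recovers the midpoint.\<close>
  define F where "F = (\<lambda>x. x - (1/2) *\<^sub>R X x)"
  define F' where "F' = (\<lambda>x v. v - (1/2) *\<^sub>R frechet_derivative X (at x) v)"
  have X: "Ck_on k UNIV X" for k
    using assms(4) by (simp add: smooth_on_def)
  have F_der: "(F has_derivative F' x) (at x)" for x
    unfolding F_def F'_def
    by (intro has_derivative_diff has_derivative_ident has_derivative_scaleR_right Ck_on_SucD(1)[OF X] UNIV_I)
  have F_Ck: "Ck_on k UNIV F" for k
    unfolding F_def by (intro Ck_on_diff Ck_on_scaleR Ck_on_ident Ck_on_const X open_UNIV)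
  have F'_lin: "bounded_linear (F' x)" for x
    using F_der has_derivative_bounded_linear by blast
  have F'_cont: "continuous_on UNIV (\<lambda>x. F' x v)" for v
    unfolding F'_def using Ck_on_imp_continuous_on[OF Ck_on_SucD(2)[OF X[of 1, unfolded One_nat_def]]]
    by (intro continuous_intros)
  \<comment> \<open>The inverse function theorem asks for a derivative continuous as a bounded
    linear map; in finite dimension this is checked direction by direction.\<close>
  define BF where "BF = (\<lambda>x. Blinfun (F' x))"
  have BF: "blinfun_apply (BF x) = F' x" for x
    unfolding BF_def by (rule bounded_linear_Blinfun_apply[OF F'_lin])
  have BF_cont: "continuous_on W BF"
    by (rule continuous_on_blinfun_componentwise)
       (simp add: BF continuous_on_subset[OF F'_cont])
  have F'm: "F' m = (\<lambda>a. a - A a)"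
    by (simp add: F'_def A)
  have "linear (F' m)" using F'_lin bounded_linear.linear by blast
  from linear_injective_left_inverse[OF this] inj F'm
  obtain g0 where g0: "linear g0" "g0 \<circ> F' m = id" by auto
  have "Blinfun g0 o\<^sub>L BF m = id_blinfun"
  proof (rule blinfun_eqI)
    show "blinfun_apply (Blinfun g0 o\<^sub>L BF m) a = blinfun_apply id_blinfun a" for a
      using g0 by (simp add: BF bounded_linear_Blinfun_apply linear_conv_bounded_linear o_def fun_eq_iff)
  qed
  from inverse_function_theorem[OF \<open>open W\<close> _ BF_cont \<open>m \<in> W\<close> this, of F]
  obtain N V g g' where N: "open N" "N \<subseteq> W" "m \<in> N" "open V" "F m \<in> V" "homeomorphism N V F g"
    and g': "\<And>y. y \<in> V \<Longrightarrow> (g has_derivative g' y) (at y)"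
    by (metis BF F_der)
  have gN: "g y \<in> N" and Fg: "F (g y) = y" if "y \<in> V" for y
    using N(6) that unfolding homeomorphism_def by auto
  have gF: "g (F x) = x" if "x \<in> N" for x
    using N(6) that unfolding homeomorphism_def by auto
  have g_Ck: "Ck_on k V g" for k
    by (rule Ck_on_inverse_map[OF \<open>open V\<close> open_UNIV, of F g g'])
       (use F_Ck N g' Fg in \<open>auto simp: smooth_on_def homeomorphism_def\<close>)
  \<comment> \<open>The endpoint is the reflection of the starting point in the midpoint
    \<open>g y\<close>.\<close>
  define \<Phi> where "\<Phi> = (\<lambda>y. 2 *\<^sub>R g y - y)"
  have mid: "midpoint y (\<Phi> y) = g y" for y
    by (simp add: midpoint_def \<Phi>_def)
  have step: "\<Phi> y - y = X (g y)" if "y \<in> V" for y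
  proof -
    have "y = g y - (1/2) *\<^sub>R X (g y)"
      using Fg[OF that] by (simp add: F_def)
    from arg_cong[OF this, of "scaleR 2"] have "2 *\<^sub>R y = 2 *\<^sub>R g y - X (g y)"
      by (simp add: scaleR_right_diff_distrib)
    then show ?thesis
      by (simp add: \<Phi>_def scaleR_2 algebra_simps)
  qed
  have Fm: "F m = m - (1/2) *\<^sub>R X m"
    by (simp add: F_def)
  show thesis
  proof
    show "implicit_discrete_flow \<alpha> W H h V \<Phi>"
      unfolding implicit_discrete_flow_def discrete_EL_iff[OF \<open>h > 0\<close>] mid
    proof (intro conjI ballI)
      show "open V" by fact
      show "smooth_on V \<Phi>"
        unfolding smooth_on_def \<Phi>_def
        by (intro allI Ck_on_diff Ck_on_scaleR Ck_on_const Ck_on_ident g_Ck \<open>open V\<close>)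
      fix y assume "y \<in> V"
      then show "g y \<in> W" using gN N(2) by blast
      then show "EL_matrix \<alpha> (g y) *v (\<Phi> y - y) = - h *\<^sub>R function_differential H (g y)"
        using EL step[OF \<open>y \<in> V\<close>] by simp
    qed
    show "m - (1/2) *\<^sub>R X m \<in> V"
      using N(5) Fm by simp
    have gFm: "g (m - (1/2) *\<^sub>R X m) = m"
      using gF[OF N(3)] Fm by simp
    show "\<Phi> (m - (1/2) *\<^sub>R X m) = m + (1/2) *\<^sub>R X m"
      by (simp add: \<Phi>_def gFm scaleR_2)
    fix a
    have g'Fm: "(g has_derivative g' (F m)) (at (F m))"
      by (rule g'[OF N(5)])
    have "(g \<circ> F has_derivative g' (F m) \<circ> F' m) (at m)"
      by (rule diff_chain_at[OF F_der g'Fm])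
    moreover have "(g \<circ> F has_derivative (\<lambda>v. v)) (at m)"
      by (rule has_derivative_transform_within_open[OF has_derivative_ident N(1,3)]) (simp add: gF)
    \<comment> \<open>The derivative of \<open>g\<close> therefore inverts \<open>F' m\<close>, that
      is, it sends \<open>a - A a\<close> to \<open>a\<close>.\<close>
    ultimately have "g' (F m) \<circ> F' m = (\<lambda>v. v)"
      by (rule has_derivative_unique)
    then have "g' (F m) (a - A a) = a"
      by (simp add: F'm o_def fun_eq_iff)
    moreover have "(\<Phi> has_derivative (\<lambda>v. 2 *\<^sub>R g' (F m) v - v)) (at (F m))"
      unfolding \<Phi>_def
      by (intro has_derivative_diff has_derivative_scaleR_right g'Fm has_derivative_ident)
    ultimately show "frechet_derivative \<Phi> (at (m - (1/2) *\<^sub>R X m)) (a - A a) = a + A a"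
      by (simp add: frechet_derivative_at[symmetric] Fm scaleR_2)
  qed
qed

section \<open>Reflection symmetry of the matrix about points of \<open>W\<close>\<close>

lemma EL_matrix_solvable:
  assumes "\<And>q. det (EL_matrix \<alpha> q) \<noteq> 0"
  shows "\<exists>X. \<forall>q. EL_matrix \<alpha> q *v X q = b q"
proof (rule choice, rule allI)
  fix q
  obtain B where "EL_matrix \<alpha> q ** B = mat 1"
    using assms[of q] unfolding invertible_det_nz[symmetric] invertible_def by blast
  then have "EL_matrix \<alpha> q *v (B *v b q) = b q"
    by (simp add: matrix_vector_mul_assoc)
  then show "\<exists>x. EL_matrix \<alpha> q *v x = b q" ..
qed

lemma Ck_on_EL_matrix:
  assumes "smooth_on UNIV \<alpha>"
  shows "Ck_on k UNIV (\<lambda>q. EL_matrix \<alpha> q $ i $ j)"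
proof -
  have "Ck_on (Suc k) UNIV (\<lambda>x. \<alpha> x $ i)" for i
    using assms unfolding smooth_on_def by (blast intro: Ck_on_vec_nth)
  then show ?thesis
    by (simp add: EL_matrix_def partial_def del: Ck_on.simps)
       (intro Ck_on_diff Ck_on_SucD(2) open_UNIV)
qed

lemma bilinear_ext_deriv: "bilinear (ext_deriv \<alpha> q)"
  unfolding bilinear_def ext_deriv_eq_EL_matrix
  by (simp add: bounded_linear.linear[OF bounded_linear_inner_left] bounded_linear.linear[OF
      bounded_linear_compose[OF bounded_linear_inner_right matrix_vector_mul_bounded_linear]])

text \<open>The step field of the test Hamiltonian is \<open>Y + t Z\<close>, with \<open>Y\<close>
  from its linear and \<open>Z\<close> from its quadratic part. Since \<open>Z m = 0\<close>, the
  step at \<open>m\<close> is \<open>2 x\<close> for every \<open>t\<close>, while \<open>t\<close>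
  still enters the linearization through the derivative of \<open>Z\<close>.\<close>

lemma preserved_imp_EL_matrix_reflection:
  assumes "h > 0" "open W" "m \<in> W" "smooth_on UNIV \<alpha>" and det: "\<And>q. det (EL_matrix \<alpha> q) \<noteq> 0"
    and pres: "\<And>H U \<Phi>. smooth_on W H \<Longrightarrow> implicit_discrete_flow \<alpha> W H h U \<Phi> \<Longrightarrow>
      preserves_form_on U \<Phi> (ext_deriv \<alpha>)"
  shows "EL_matrix \<alpha> (m + x) = EL_matrix \<alpha> (m - x)"
proof -
  let ?M = "EL_matrix \<alpha>"
  obtain Y where Y: "\<And>q. ?M q *v Y q = ?M m *v (2 *\<^sub>R x)"
    using EL_matrix_solvable[OF det, of "\<lambda>_. ?M m *v (2 *\<^sub>R x)"] by blast
  obtain Z where Z: "\<And>q. ?M q *v Z q = - h *\<^sub>R (q - m)"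
    using EL_matrix_solvable[OF det, of "\<lambda>q. - h *\<^sub>R (q - m)"] by blast
  have M_inj: "u = v" if "?M q *v u = ?M q *v v" for q u v
    using det[of q] that by (metis injD inj_matrix_vector_mult invertible_det_nz)
  have Ym: "Y m = 2 *\<^sub>R x" using M_inj[OF Y] .
  have Zm: "Z m = 0" using M_inj[of m "Z m" 0] Z[of m] by simp
  have Y_Ck: "Ck_on k UNIV Y" for k
    by (rule Ck_on_linear_solve[OF open_UNIV Ck_on_EL_matrix[OF assms(4)] _ det Y])
       (rule Ck_on_const)
  have Z_Ck: "Ck_on k UNIV Z" for k
    by (rule Ck_on_linear_solve[OF open_UNIV Ck_on_EL_matrix[OF assms(4)] _ det Z])
       (intro Ck_on_vec_nth Ck_on_scaleR Ck_on_diff Ck_on_ident Ck_on_const open_UNIV)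
  define DY where "DY = frechet_derivative Y (at m)"
  define DZ where "DZ = frechet_derivative Z (at m)"
  have DY: "(Y has_derivative DY) (at m)" and DZ: "(Z has_derivative DZ) (at m)"
    unfolding DY_def DZ_def using Ck_on_SucD(1)[OF Y_Ck] Ck_on_SucD(1)[OF Z_Ck] by blast+
  have lin: "linear DY" "linear DZ"
    using DY DZ has_derivative_linear by blast+
  \<comment> \<open>The product rule is applied to the equation defining \<open>Z\<close>; the term
    with the derivative of the matrix vanishes because \<open>Z m = 0\<close>.\<close>
  have MDZ: "?M m *v DZ v = - h *\<^sub>R v" for v
  proof (rule vec_eq_iff[THEN iffD2], rule allI)
    fix i
    define DM where "DM = (\<lambda>j. frechet_derivative (\<lambda>q. ?M q $ i $ j) (at m))"
    have DM: "((\<lambda>q. ?M q $ i $ j) has_derivative DM j) (at m)" for j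
      unfolding DM_def using Ck_on_SucD(1)[OF Ck_on_EL_matrix[OF assms(4)]] by blast
    have "((\<lambda>q. \<Sum>j\<in>UNIV. ?M q $ i $ j * Z q $ j) has_derivative
        (\<lambda>v. \<Sum>j\<in>UNIV. ?M m $ i $ j * DZ v $ j + DM j v * Z m $ j)) (at m)"
      by (intro has_derivative_sum has_derivative_mult DM
          bounded_linear.has_derivative[OF bounded_linear_vec_nth DZ])
    moreover have "(\<lambda>q. \<Sum>j\<in>UNIV. ?M q $ i $ j * Z q $ j) = (\<lambda>q. (- h *\<^sub>R (q - m)) $ i)"
      unfolding Z[symmetric] by (simp add: matrix_vector_mult_def)
    moreover have "((\<lambda>q. (- h *\<^sub>R (q - m)) $ i) has_derivative (\<lambda>v. (- h *\<^sub>R (v - 0)) $ i)) (at m)"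
      by (intro bounded_linear.has_derivative[OF bounded_linear_vec_nth] has_derivative_scaleR_right
          has_derivative_diff has_derivative_ident has_derivative_const)
    ultimately have "(\<lambda>v. \<Sum>j\<in>UNIV. ?M m $ i $ j * DZ v $ j + DM j v * Z m $ j)
        = (\<lambda>v. (- h *\<^sub>R (v - 0)) $ i)"
      by (simp only:) (rule has_derivative_unique)
    from fun_cong[OF this, of v] show "(?M m *v DZ v) $ i = (- h *\<^sub>R v) $ i"
      by (simp add: Zm matrix_vector_mult_def)
  qed
  have "inj DZ"
  proof (rule injI)
    fix u v assume "DZ u = DZ v"
    then have "- h *\<^sub>R u = - h *\<^sub>R v"
      using MDZ by metis
    then show "u = v" using \<open>h > 0\<close> by simp
  qed
  \<comment> \<open>Chosen so that \<open>- h *\<^sub>R c\<close> is the right-hand side solved by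
    \<open>Y\<close>.\<close>
  define c where "c = - (1 / h) *\<^sub>R (?M m *v (2 *\<^sub>R x))"
  have "ext_deriv \<alpha> (m + x) u v = ext_deriv \<alpha> (m - x) u v" for u v
  proof (rule bilinear_eq_from_midpoint_family[OF bilinear_ext_deriv bilinear_ext_deriv,
        where B = "\<lambda>a. (1/2) *\<^sub>R DY a" and R = "\<lambda>a. (1/2) *\<^sub>R DZ a"])
    show "linear (\<lambda>a. (1/2) *\<^sub>R DY a)" "linear (\<lambda>a. (1/2) *\<^sub>R DZ a)"
      by (intro linear_compose_scale_right lin)+
    show "inj (\<lambda>a. (1/2) *\<^sub>R DZ a)"
      using \<open>inj DZ\<close> by (simp add: inj_def)
    fix t a b
    \<comment> \<open>Half the derivative of the step field at \<open>m\<close>. Injectivity of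
      \<open>a - ?A a\<close> is what makes the midpoint locally recoverable from the starting
      point.\<close>
    let ?A = "\<lambda>a. (1/2) *\<^sub>R DY a + t *\<^sub>R (1/2) *\<^sub>R DZ a"
    assume inj: "inj (\<lambda>a. a - ?A a)"
    define H where "H = (\<lambda>y. c \<bullet> (y - m) + (t / 2) * ((y - m) \<bullet> (y - m)))"
    define X where "X = (\<lambda>y. Y y + t *\<^sub>R Z y)"
    have H_Ck: "Ck_on k W H" for k
      unfolding H_def
      by (intro Ck_on_add Ck_on_mult Ck_on_const Ck_on_bounded_bilinear[OF _ bounded_bilinear_inner]
          Ck_on_diff Ck_on_ident \<open>open W\<close>)
    have X_Ck: "Ck_on k UNIV X" for k
      unfolding X_def by (intro Ck_on_add Ck_on_scaleR Ck_on_const Y_Ck Z_Ck open_UNIV)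
    have grad: "function_differential H y = c + t *\<^sub>R (y - m)" for y
    proof -
      have "(H has_derivative (\<lambda>v. (c + t *\<^sub>R (y - m)) \<bullet> v)) (at y)"
        unfolding H_def
        by (auto intro!: derivative_eq_intros simp: fun_eq_iff inner_simps inner_commute algebra_simps)
      from frechet_derivative_at[OF this, symmetric] show ?thesis
        by (simp add: vec_eq_iff function_differential_def partial_def inner_axis)
    qed
    have EL: "?M y *v X y = - h *\<^sub>R function_differential H y" for y
      using \<open>h > 0\<close> by (simp add: X_def grad matrix_vector_right_distrib matrix_vector_mult_scaleR Y Z c_def
          scaleR_add_right scaleR_diff_right algebra_simps)
    have DX: "frechet_derivative X (at m) v = 2 *\<^sub>R ?A v" for v
    proof -
      have "(X has_derivative (\<lambda>v. DY v + t *\<^sub>R DZ v)) (at m)"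
        unfolding X_def by (intro has_derivative_add has_derivative_scaleR_right DY DZ)
      from frechet_derivative_at[OF this, symmetric] show ?thesis
        by (simp add: scaleR_add_right)
    qed
    have Xm: "(1/2) *\<^sub>R X m = x"
      by (simp add: X_def Ym Zm)
    obtain U \<Phi> where flow: "implicit_discrete_flow \<alpha> W H h U \<Phi>" and U: "m - x \<in> U"
      "\<Phi> (m - x) = m + x" and D\<Phi>: "\<And>a. frechet_derivative \<Phi> (at (m - x)) (a - ?A a) = a + ?A a"
      using midpoint_flow_exists[OF \<open>h > 0\<close> \<open>open W\<close> \<open>m \<in> W\<close> _ EL DX inj] X_Ck
      unfolding Xm smooth_on_def by blast
    have "preserves_form_on U \<Phi> (ext_deriv \<alpha>)"
      using pres[OF _ flow] H_Ck by (simp add: smooth_on_def)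
    then have "pullback \<Phi> (ext_deriv \<alpha>) (m - x) (a - ?A a) (b - ?A b) = ext_deriv \<alpha> (m - x) (a - ?A a) (b - ?A b)"
      using U(1) by (simp add: preserves_form_on_def)
    then show "ext_deriv \<alpha> (m + x) (a + ?A a) (b + ?A b) = ext_deriv \<alpha> (m - x) (a - ?A a) (b - ?A b)"
      unfolding pullback_def U(2) D\<Phi> .
  qed
  then have "?M (m + x) *v u = ?M (m - x) *v u" for u
    unfolding ext_deriv_eq_EL_matrix by (metis vector_eq_ldot)
  then show ?thesis
    by (simp add: matrix_eq)
qed

text \<open>Reflecting in \<open>m\<close> and then in \<open>m + d\<close> is translation by
  \<open>2 d\<close>. Hence \<open>f\<close> is invariant under all small translations, so locally
  constant, and the whole space is connected.\<close>

lemma reflection_invariant_imp_constant: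
  fixes f :: "'a::real_normed_vector \<Rightarrow> 'b"
  assumes "open W" "W \<noteq> {}" and refl: "\<And>m x. m \<in> W \<Longrightarrow> f (m + x) = f (m - x)"
  shows "f p = f q"
proof -
  obtain m r where "r > 0" and r: "ball m r \<subseteq> W"
    using assms(1,2) open_contains_ball by blast
  have near: "f y = f z" if "dist z y < 2 * r" for y z
  proof -
    define d where "d = (1/2) *\<^sub>R (z - y)"
    have "d + d = z - y"
      unfolding d_def scaleR_left_distrib[symmetric] by simp
    then have z: "z = y + d + d"
      by (simp add: add.assoc)
    have "norm d < r"
      using that by (simp add: d_def dist_norm)
    then have "m \<in> W" "m + d \<in> W"
      using r \<open>r > 0\<close> by (auto simp: dist_norm intro!: subsetD[OF r])
    have "f y = f (m + (y - m))" by simp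
    also have "\<dots> = f (m - (y - m))" by (rule refl[OF \<open>m \<in> W\<close>])
    also have "m - (y - m) = (m + d) - (z - (m + d))"
      by (simp add: z algebra_simps)
    also have "f \<dots> = f ((m + d) + (z - (m + d)))"
      by (rule refl[OF \<open>m + d \<in> W\<close>, symmetric])
    finally show ?thesis by simp
  qed
  have "\<forall>\<^sub>F z in at y. f y = f z" for y
    unfolding eventually_at using near \<open>r > 0\<close> by (intro exI[of _ "2 * r"]) auto
  then show ?thesis
    using connected_local_const[of "UNIV :: 'a set" p q f] connected_UNIV by auto
qed

text \<open>For constant \<open>H\<close> nondegeneracy forces the step to be the identity, which
  preserves every form; preservation is therefore demanded for all \<open>H\<close>. The exact term
  appears because the equations and the two-form see \<open>\<alpha>\<close> only through its
  exterior derivative.\<close>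

theorem proposition6p3:
  fixes n :: nat and h :: real
    and \<alpha> :: "real^'m::finite \<Rightarrow> real^'m"
    and W :: "(real^'m) set"
  assumes "CARD('m) = 2 * n"
    and "smooth_on UNIV \<alpha>"
    and "symplectic_form (ext_deriv \<alpha>)"
    and "open W" and "W \<noteq> {}"
    and "h > 0"
  shows "(\<forall>H. smooth_on W H \<longrightarrow>
            (\<forall>U \<Phi>. implicit_discrete_flow \<alpha> W H h U \<Phi> \<longrightarrow> preserves_form_on U \<Phi> (ext_deriv \<alpha>)))
         \<longleftrightarrow>
         (\<exists>\<beta> f. linear_components \<beta> \<and> smooth_on UNIV f \<and>
            (\<forall>q. \<alpha> q = \<beta> q + function_differential f q))"
    (is "?preserved \<longleftrightarrow> ?linear")
proof
  assume preserved: ?preserved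
  \<comment> \<open>Nondegeneracy of the symplectic form, read off the matrix.\<close>
  have "det (EL_matrix \<alpha> q) \<noteq> 0" for q
  proof -
    have "u = 0" if "EL_matrix \<alpha> q *v u = 0" for u
    proof -
      have "ext_deriv \<alpha> q u v = 0" for v
        using that by (simp add: ext_deriv_eq_EL_matrix)
      then show ?thesis
        using assms(3) unfolding symplectic_form_def by blast
    qed
    then show ?thesis
      using det_nz_iff_inj[OF matrix_vector_mul_linear, of "EL_matrix \<alpha> q"]
        linear_injective_0[OF matrix_vector_mul_linear, of "EL_matrix \<alpha> q"] by simp
  qed
  then have "EL_matrix \<alpha> (m + x) = EL_matrix \<alpha> (m - x)" if "m \<in> W" for m x
    using preserved_imp_EL_matrix_reflection[OF assms(6,4) that assms(2)] preserved by blast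
  then have "EL_matrix \<alpha> q = EL_matrix \<alpha> 0" for q
    by (rule reflection_invariant_imp_constant[OF assms(4,5)])
  then show ?linear
    using constant_EL_matrix_imp_linear_plus_exact[OF assms(2)] by metis
next
  assume ?linear
  then have "EL_matrix \<alpha> q = EL_matrix \<alpha> 0" for q
    using linear_plus_exact_EL_matrix by blast
  then show ?preserved
    using constant_EL_matrix_preserves[OF assms(6,4)] by blast
qed

end
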